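(* Let $N\ge2$ and consider a Markov renewal process on $\{1,\dots,N\}$ with irreducible transition matrix $P=[p_{ij}]$, mean holding times $\mu_1,\dots,\mu_N$ and mean first passage time matrix $M=[m_{ij}]$. For each $k=1,\dots,N$ put $\sigma_k(a)=((a+k-2)\bmod N)+1$ for $a=1,\dots,N$, and start the following recursion from the cyclically relabelled data $p_{ab}^{(N)}=p_{\sigma_k(a)\sigma_k(b)}$, $\mu_a^{(N)}=\mu_{\sigma_k(a)}$: (i) for $n=N,N-1,\dots,2$, let $S(n)=\sum_{j=1}^{n-1}p_{nj}^{(n)}$ and $p_{ij}^{(n-1)}=p_{ij}^{(n)}+\dfrac{p_{in}^{(n)}p_{nj}^{(n)}}{S(n)}$ for $1\le i,j\le n-1$; (ii) for $n=N,N-1,\dots,2$, let $\mu_i^{(n-1)}=\mu_i^{(n)}+\dfrac{\mu_n^{(n)}p_{in}^{(n)}}{S(n)}$ for $1\le i\le n-1$; (iii) let $x_1=\mu_1^{(1)}$, $x_2=\dfrac{\mu_2^{(2)}}{S(2)}$, and $x_i=\dfrac{\mu_i^{(i)}+\sum_{l=2}^{i-1}p_{il}^{(i)}x_l}{S(i)}$ for $i=3,\dots,N$. Then the resulting vector gives the $k$-th column of $M$: $(x_1,\dots,x_N)=(m_{kk},m_{k+1,k},\dots,m_{Nk},m_{1k},\dots,m_{k-1,k})$, i.e. $x_a=m_{\sigma_k(a),k}$ for $a=1,\dots,N$. Consequently, carrying this out for $k=1,\dots,N$ computes the whole matrix $M$.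
   Context: A Markov renewal process (MRP) $\{(X_k,T_k),k\ge0\}$, $T_0=0$, on $\{1,\dots,N\}$ has semi-Markov kernel $Q_{ij}(t)=P\{X_{k+1}=j,T_{k+1}-T_k\le t\mid X_k=i\}$. The embedded Markov chain has transition matrix $P=[p_{ij}]$, $p_{ij}=Q_{ij}(+\infty)$, assumed irreducible; mean holding times $\mu_i=E[T_{k+1}-T_k\mid X_k=i]$ are assumed finite. The mean first passage time $m_{ij}$ is $E[T_\kappa\mid X_0=i]$ with $\kappa=\min\{k\ge1:X_k=j\}$ (the mean recurrence time if $i=j$); these are the unique solution of $m_{ij}=\mu_i+\sum_{l\ne j}p_{il}m_{lj}$, $1\le i,j\le N$. A discrete-time Markov chain is the special case $\mu_i=1$ for all $i$. *)

theory Defs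
  imports "HOL-Probability.Probability"
begin

text \<open>The \<sigma>-algebra generated by \<open>X\<^sub>0, \<dots>, X\<^sub>k, T\<^sub>0, \<dots>, T\<^sub>k\<close>.\<close>

definition history ::
    "'a measure \<Rightarrow> (nat \<Rightarrow> 'a \<Rightarrow> nat) \<Rightarrow> (nat \<Rightarrow> 'a \<Rightarrow> real) \<Rightarrow> nat \<Rightarrow> 'a measure" where
  "history M X T k = sigma (space M)
     ((\<Union>l\<in>{..k}. {X l -` A \<inter> space M | A. True}) \<union>
      (\<Union>l\<in>{..k}. {T l -` B \<inter> space M | B. B \<in> sets borel}))"

text \<open>
  Time-homogeneous Markov renewal process on \<open>{1..N}\<close> with semi-Markov kernel \<open>Q\<close>.
  The last assumption says
  \<open>P(X\<^sub>k\<^sub>+\<^sub>1 = j, T\<^sub>k\<^sub>+\<^sub>1 - T\<^sub>k \<le> t | X\<^sub>0, \<dots>, X\<^sub>k, T\<^sub>0, \<dots>, T\<^sub>k) = Q X\<^sub>k j t\<close> almost surely;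
  hence \<open>P(X\<^sub>k\<^sub>+\<^sub>1 = j, T\<^sub>k\<^sub>+\<^sub>1 - T\<^sub>k \<le> t | X\<^sub>k = i) = Q i j t\<close> whenever \<open>P(X\<^sub>k = i) > 0\<close>.
  Holding times are finite and nonnegative, and may vanish.
\<close>

locale markov_renewal_process = prob_space M
  for M :: "'a measure" +
  fixes N :: nat
    and Q :: "nat \<Rightarrow> nat \<Rightarrow> real \<Rightarrow> real"
    and X :: "nat \<Rightarrow> 'a \<Rightarrow> nat"
    and T :: "nat \<Rightarrow> 'a \<Rightarrow> real"
  assumes X_measurable: "\<And>k. X k \<in> measurable M (count_space UNIV)"
    and T_measurable: "\<And>k. T k \<in> borel_measurable M"
    and X_range: "\<And>k \<omega>. \<omega> \<in> space M \<Longrightarrow> X k \<omega> \<in> {1..N}"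
    and T_0: "\<And>\<omega>. \<omega> \<in> space M \<Longrightarrow> T 0 \<omega> = 0"
    and T_mono: "\<And>k \<omega>. \<omega> \<in> space M \<Longrightarrow> T k \<omega> \<le> T (Suc k) \<omega>"
    and markov_renewal: "\<And>k j t. j \<in> {1..N} \<Longrightarrow>
      AE \<omega> in M. real_cond_exp M (history M X T k)
        (indicator {\<omega> \<in> space M. X (Suc k) \<omega> = j \<and> T (Suc k) \<omega> - T k \<omega> \<le> t}) \<omega>
        = Q (X k \<omega>) j t"

definition transition_prob :: "(nat \<Rightarrow> nat \<Rightarrow> real \<Rightarrow> real) \<Rightarrow> nat \<Rightarrow> nat \<Rightarrow> real" where
  "transition_prob Q i j = Lim at_top (Q i j)"

primrec n_step_prob :: "nat \<Rightarrow> (nat \<Rightarrow> nat \<Rightarrow> real) \<Rightarrow> nat \<Rightarrow> nat \<Rightarrow> nat \<Rightarrow> real" where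
  "n_step_prob N p 0 i j = (if i = j then 1 else 0)"
| "n_step_prob N p (Suc n) i j = (\<Sum>l=1..N. p i l * n_step_prob N p n l j)"

definition irreducible_chain :: "nat \<Rightarrow> (nat \<Rightarrow> nat \<Rightarrow> real) \<Rightarrow> bool" where
  "irreducible_chain N p \<longleftrightarrow> (\<forall>i\<in>{1..N}. \<forall>j\<in>{1..N}. \<exists>n. n_step_prob N p n i j > 0)"

text \<open>
  \<open>E[Y | X\<^sub>0 = i]\<close> for \<open>Y\<close> with values in \<open>[0, \<infinity>]\<close>; meaningful only if \<open>P(X\<^sub>0 = i) > 0\<close>.
\<close>

definition expect_from ::
    "'a measure \<Rightarrow> (nat \<Rightarrow> 'a \<Rightarrow> nat) \<Rightarrow> nat \<Rightarrow> ('a \<Rightarrow> ennreal) \<Rightarrow> ennreal" where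
  "expect_from M X i Y = (\<integral>\<^sup>+ \<omega>. Y \<omega> \<partial>uniform_measure M {\<omega> \<in> space M. X 0 \<omega> = i})"

text \<open>
  By homogeneity \<open>E[T\<^sub>k\<^sub>+\<^sub>1 - T\<^sub>k | X\<^sub>k = i]\<close> is the same for all \<open>k\<close>; the case \<open>k = 0\<close> is used.
\<close>

definition mean_holding_time ::
    "'a measure \<Rightarrow> (nat \<Rightarrow> 'a \<Rightarrow> nat) \<Rightarrow> (nat \<Rightarrow> 'a \<Rightarrow> real) \<Rightarrow> nat \<Rightarrow> ennreal" where
  "mean_holding_time M X T i = expect_from M X i (\<lambda>\<omega>. ennreal (T 1 \<omega> - T 0 \<omega>))"

text \<open>\<open>T\<^sub>\<kappa>\<close> for \<open>\<kappa> = min {k \<ge> 1. X\<^sub>k = j}\<close>, infinite if \<open>j\<close> is never visited.\<close>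

definition first_passage_time ::
    "(nat \<Rightarrow> 'a \<Rightarrow> nat) \<Rightarrow> (nat \<Rightarrow> 'a \<Rightarrow> real) \<Rightarrow> nat \<Rightarrow> 'a \<Rightarrow> ennreal" where
  "first_passage_time X T j \<omega> =
     (if \<exists>k\<ge>1. X k \<omega> = j then ennreal (T (LEAST k. k \<ge> 1 \<and> X k \<omega> = j) \<omega>) else \<infinity>)"

definition mean_first_passage_time ::
    "'a measure \<Rightarrow> (nat \<Rightarrow> 'a \<Rightarrow> nat) \<Rightarrow> (nat \<Rightarrow> 'a \<Rightarrow> real) \<Rightarrow> nat \<Rightarrow> nat \<Rightarrow> ennreal" where
  "mean_first_passage_time M X T i j = expect_from M X i (first_passage_time X T j)"

definition cyc :: "nat \<Rightarrow> nat \<Rightarrow> nat \<Rightarrow> nat" where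
  "cyc N k a = (a + k - 2) mod N + 1"

text \<open>
  The recursion from initial data \<open>p\<close>, \<open>\<mu>\<close> on \<open>{1..N}\<close>: \<open>red_p N p n\<close> and \<open>red_mu N p \<mu> n\<close> are
  \<open>p\<^sup>(\<^sup>n\<^sup>)\<close> and \<open>\<mu>\<^sup>(\<^sup>n\<^sup>)\<close>, computed downwards from \<open>n = N\<close>, and \<open>row_sum (red_p N p n) n\<close> is
  \<open>S(n)\<close>. The values for \<open>n = 0\<close> or \<open>n > N\<close>, and entries with an index outside \<open>{1..n}\<close>,
  are irrelevant.
\<close>

definition row_sum :: "(nat \<Rightarrow> nat \<Rightarrow> real) \<Rightarrow> nat \<Rightarrow> real" where
  "row_sum p n = (\<Sum>j=1..n-1. p n j)"

function red_p :: "nat \<Rightarrow> (nat \<Rightarrow> nat \<Rightarrow> real) \<Rightarrow> nat \<Rightarrow> nat \<Rightarrow> nat \<Rightarrow> real" where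
  "red_p N p n i j =
     (if n \<ge> N then p i j
      else red_p N p (Suc n) i j
        + red_p N p (Suc n) i (Suc n) * red_p N p (Suc n) (Suc n) j
          / row_sum (red_p N p (Suc n)) (Suc n))"
  by auto
termination
  by (relation "Wellfounded.measure (\<lambda>(N, p, n, i, j). N - n)") auto

function red_mu ::
    "nat \<Rightarrow> (nat \<Rightarrow> nat \<Rightarrow> real) \<Rightarrow> (nat \<Rightarrow> real) \<Rightarrow> nat \<Rightarrow> nat \<Rightarrow> real" where
  "red_mu N p \<mu> n i =
     (if n \<ge> N then \<mu> i
      else red_mu N p \<mu> (Suc n) i
        + red_mu N p \<mu> (Suc n) (Suc n) * red_p N p (Suc n) i (Suc n)
          / row_sum (red_p N p (Suc n)) (Suc n))"
  by auto
termination
  by (relation "Wellfounded.measure (\<lambda>(N, p, \<mu>, n, i). N - n)") auto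

declare red_p.simps [simp del] red_mu.simps [simp del]

function passage_vec ::
    "nat \<Rightarrow> (nat \<Rightarrow> nat \<Rightarrow> real) \<Rightarrow> (nat \<Rightarrow> real) \<Rightarrow> nat \<Rightarrow> real" where
  "passage_vec N p \<mu> i =
     (if i \<le> 1 then red_mu N p \<mu> 1 1
      else if i = 2 then red_mu N p \<mu> 2 2 / row_sum (red_p N p 2) 2
      else (red_mu N p \<mu> i i + (\<Sum>l=2..i-1. red_p N p i i l * passage_vec N p \<mu> l))
           / row_sum (red_p N p i) i)"
  by auto
termination
  by (relation "Wellfounded.measure (\<lambda>(N, p, \<mu>, i). i)") auto

declare passage_vec.simps [simp del]

end

theory Submission
  imports Defs
begin

text \<open>The reduction (i), (ii) is censoring: eliminating state \<open>n\<close> keeps the matrix stochastic and keeps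
  every proper subset of states leaky, so that \<open>S(n) = 1 - p\<^sub>n\<^sub>n > 0\<close>. It is at the same time Gaussian
  elimination, so (iii) yields a nonnegative solution \<open>y\<close> of \<open>y = \<mu> + A y\<close>, where \<open>A\<close> is \<open>P\<close> with
  column \<open>k\<close> deleted. Iterating, \<open>y = \<Sum>\<^sub>m\<^sub><\<^sub>n A\<^sup>m \<mu> + A\<^sup>n y\<close>. With \<open>\<mu> = 1\<close> this bounds \<open>\<Sum>\<^sub>m A\<^sup>m 1\<close>, so
  \<open>A\<^sup>n 1\<close> tends to \<open>0\<close>; hence \<open>y = \<Sum>\<^sub>m A\<^sup>m \<mu>\<close> for every \<open>\<mu>\<close>, with no spectral theory and no separate
  uniqueness argument. On the probabilistic side \<open>A\<^sup>n 1\<close> is the vector of the \<open>P(\<kappa> > n | X\<^sub>0 = i)\<close>, and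
  \<open>T\<^sub>\<kappa>\<close> is the sum over \<open>n\<close> of the holding times \<open>T\<^sub>n\<^sub>+\<^sub>1 - T\<^sub>n\<close> on \<open>{\<kappa> > n}\<close>, whose expectations are
  \<open>A\<^sup>n \<mu>\<close>.\<close>

section \<open>Elimination of states\<close>

definition stochastic_on :: "nat \<Rightarrow> (nat \<Rightarrow> nat \<Rightarrow> real) \<Rightarrow> bool" where
  "stochastic_on n p \<longleftrightarrow>
     (\<forall>i\<in>{1..n}. (\<forall>j\<in>{1..n}. 0 \<le> p i j) \<and> (\<Sum>j=1..n. p i j) = 1)"

text \<open>Irreducibility in terms of single steps. In this form it passes to the censored chain by
  inspecting two edges, where whole paths would have to be rebuilt.\<close>

definition no_closed_subset :: "nat \<Rightarrow> (nat \<Rightarrow> nat \<Rightarrow> real) \<Rightarrow> bool" where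
  "no_closed_subset n p \<longleftrightarrow>
     (\<forall>A. A \<subset> {1..n} \<longrightarrow> A \<noteq> {} \<longrightarrow> (\<exists>i\<in>A. \<exists>j\<in>{1..n} - A. 0 < p i j))"

text \<open>A set closed for one step is closed for every number of steps, so no state outside it
  could be reached from inside.\<close>

lemma irreducible_no_closed_subset:
  assumes p: "stochastic_on N p" and irr: "irreducible_chain N p"
  shows "no_closed_subset N p"
  unfolding no_closed_subset_def
proof (intro allI impI, rule ccontr)
  fix A assume A: "A \<subset> {1..N}" "A \<noteq> {}"
    and closed: "\<not> (\<exists>i\<in>A. \<exists>j\<in>{1..N} - A. 0 < p i j)"
  have zero: "p i j = 0" if "i \<in> A" "j \<in> {1..N} - A" for i j
    using p A closed that unfolding stochastic_on_def
    by (meson DiffD1 linorder_not_less nle_le psubsetE subset_eq)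
  \<comment> \<open>The induction peels off the first step: it either stays in \<open>A\<close>,
    where the induction hypothesis applies, or has probability 0.\<close>
  have stay: "n_step_prob N p n i j = 0" if "i \<in> A" "j \<in> {1..N} - A" for n i j
    using that
  proof (induction n arbitrary: i)
    case (Suc n)
    have "p i l * n_step_prob N p n l j = 0" if "l \<in> {1..N}" for l
      using Suc zero[of i l] that by (cases "l \<in> A") auto
    then show ?case unfolding n_step_prob.simps by (intro sum.neutral ballI)
  qed auto
  obtain i j where "i \<in> A" "j \<in> {1..N} - A" using A by blast
  with stay irr A show False unfolding irreducible_chain_def
    by (metis DiffD1 order_less_irrefl psubsetD)
qed

lemma row_sum_stochastic:
  assumes "stochastic_on n p" "n \<ge> 1"
  shows "row_sum p n = 1 - p n n"
proof -
  have "(\<Sum>j=1..n. p n j) = row_sum p n + p n n"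
    using assms(2) by (cases n) (auto simp: row_sum_def)
  then show ?thesis using assms unfolding stochastic_on_def by force
qed

text \<open>For \<open>n \<ge> 2\<close> the singleton \<open>{n}\<close> is a proper subset, so
  some edge leaves it.\<close>

lemma row_sum_pos:
  assumes p: "stochastic_on n p" and irr: "no_closed_subset n p" and n: "n \<ge> 2"
  shows "row_sum p n > 0"
proof -
  have "{n} \<subset> {1..n}" using n by force
  then obtain j where j: "j \<in> {1..n} - {n}" "0 < p n j"
    using irr unfolding no_closed_subset_def by blast
  have "0 < (\<Sum>j\<in>{1..n-1}. p n j)"
    by (rule sum_pos2[of _ j]) (use j p n in \<open>auto simp: stochastic_on_def\<close>)
  then show ?thesis unfolding row_sum_def .
qed

text \<open>The transition matrix of the chain watched only outside \<open>n\<close>. For stochastic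
  \<open>p\<close> the divisor is \<open>1 - p n n\<close>, so the second term sums over all lengths
  of a stay at \<open>n\<close>.\<close>

definition censor :: "(nat \<Rightarrow> nat \<Rightarrow> real) \<Rightarrow> nat \<Rightarrow> nat \<Rightarrow> nat \<Rightarrow> real" where
  "censor p n i j = p i j + p i n * p n j / row_sum p n"

lemma red_p_top: "red_p N p N = p"
  by (intro ext) (subst red_p.simps, simp)

lemma red_p_step: "n < N \<Longrightarrow> red_p N p n = censor (red_p N p (Suc n)) (Suc n)"
  by (intro ext) (subst red_p.simps, simp add: censor_def)

lemma red_mu_top: "red_mu N p \<mu> N = \<mu>"
  by (intro ext) (subst red_mu.simps, simp)

lemma red_mu_step:
  "n < N \<Longrightarrow> red_mu N p \<mu> n i = red_mu N p \<mu> (Suc n) i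
     + red_p N p (Suc n) i (Suc n) / row_sum (red_p N p (Suc n)) (Suc n)
       * red_mu N p \<mu> (Suc n) (Suc n)"
  by (subst red_mu.simps) simp

text \<open>Excursions through the removed state only add probability, so edges between the
  remaining states survive.\<close>

lemma censor_ge:
  assumes p: "stochastic_on (Suc n) p" and irr: "no_closed_subset (Suc n) p" and n: "n \<ge> 1"
    and ij: "i \<in> {1..n}" "j \<in> {1..n}"
  shows "p i j \<le> censor p (Suc n) i j"
proof -
  have "row_sum p (Suc n) > 0" using row_sum_pos[OF p irr] n by simp
  then show ?thesis using p ij unfolding censor_def stochastic_on_def by auto
qed

text \<open>The mass \<open>p i (Suc n)\<close> is passed on in the proportions
  \<open>p (Suc n) j / row_sum p (Suc n)\<close>, which add up to 1.\<close>

lemma censor_stochastic: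
  assumes p: "stochastic_on (Suc n) p" and irr: "no_closed_subset (Suc n) p" and n: "n \<ge> 1"
  shows "stochastic_on n (censor p (Suc n))"
  unfolding stochastic_on_def
proof (intro ballI conjI)
  have S: "row_sum p (Suc n) > 0" using row_sum_pos[OF p irr] n by simp
  fix i assume i: "i \<in> {1..n}"
  show "0 \<le> censor p (Suc n) i j" if "j \<in> {1..n}" for j
  proof -
    have "0 \<le> p i j" using p i that unfolding stochastic_on_def by auto
    then show ?thesis using censor_ge[OF p irr n i that] by linarith
  qed
  have "(\<Sum>j=1..n. censor p (Suc n) i j)
      = (\<Sum>j=1..n. p i j) + p i (Suc n) * row_sum p (Suc n) / row_sum p (Suc n)"
    by (simp add: censor_def sum.distrib row_sum_def sum_distrib_left sum_divide_distrib)
  also have "\<dots> = (\<Sum>j=1..Suc n. p i j)" using S by simp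
  also have "\<dots> = 1" using p i unfolding stochastic_on_def by force
  finally show "(\<Sum>j=1..n. censor p (Suc n) i j) = 1" .
qed

text \<open>One edge leaves \<open>A\<close> and one leaves \<open>insert (Suc n) A\<close>. If the
  first ends and the second starts at \<open>Suc n\<close>, they compose to an excursion of positive
  weight; otherwise one of them already runs from \<open>A\<close> to
  \<open>{1..n} - A\<close>.\<close>

lemma censor_no_closed_subset:
  assumes p: "stochastic_on (Suc n) p" and irr: "no_closed_subset (Suc n) p" and n: "n \<ge> 1"
  shows "no_closed_subset n (censor p (Suc n))"
  unfolding no_closed_subset_def
proof (intro allI impI)
  fix A assume A: "A \<subset> {1..n}" "A \<noteq> {}"
  have S: "row_sum p (Suc n) > 0" using row_sum_pos[OF p irr] n by simp
  obtain i j where ij: "i \<in> A" "j \<in> {1..Suc n} - A" "0 < p i j"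
  proof -
    have "A \<subset> {1..Suc n}" using A by force
    then show ?thesis using irr A(2) that unfolding no_closed_subset_def by blast
  qed
  obtain i' j' where ij': "i' \<in> insert (Suc n) A" "j' \<in> {1..Suc n} - insert (Suc n) A" "0 < p i' j'"
  proof -
    obtain a where "a \<in> {1..n}" "a \<notin> A" using A by blast
    then have "a \<in> {1..Suc n}" "a \<notin> insert (Suc n) A" by auto
    moreover have "insert (Suc n) A \<subseteq> {1..Suc n}"
      using A by (simp add: atLeastAtMostSuc_conv) blast
    ultimately have "insert (Suc n) A \<subset> {1..Suc n}" by blast
    then obtain i' j' where "i' \<in> insert (Suc n) A" "j' \<in> {1..Suc n} - insert (Suc n) A"
      "0 < p i' j'"
      using irr unfolding no_closed_subset_def by (metis insert_not_empty)
    then show ?thesis by (rule that)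
  qed
  have nonneg: "0 \<le> p i j'"
  proof -
    have "i \<in> {1..n}" using ij(1) A(1) by blast
    then have "i \<in> {1..Suc n}" "j' \<in> {1..Suc n}" using ij'(2) by auto
    then show ?thesis using p unfolding stochastic_on_def by blast
  qed
  show "\<exists>i\<in>A. \<exists>j\<in>{1..n} - A. 0 < censor p (Suc n) i j"
  proof (cases "j = Suc n \<and> i' = Suc n")
    case True
    then have "0 < p i (Suc n) * p (Suc n) j' / row_sum p (Suc n)" using ij ij' S by simp
    then have "0 < censor p (Suc n) i j'" using nonneg unfolding censor_def by linarith
    moreover have "j' \<in> {1..n} - A" using ij'(2) by auto
    ultimately show ?thesis using ij(1) by blast
  next
    case False
    have "\<exists>a\<in>A. \<exists>b\<in>{1..n} - A. 0 < p a b"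
    proof (cases "j = Suc n")
      case True
      then have "i' \<in> A" using False ij' by simp
      moreover have "j' \<in> {1..n} - A" using ij'(2) by auto
      ultimately show ?thesis using ij'(3) by blast
    next
      case False
      then have "j \<in> {1..n} - A" using ij(2) by auto
      then show ?thesis using ij by blast
    qed
    then obtain a b where ab: "a \<in> A" "b \<in> {1..n} - A" "0 < p a b" by blast
    moreover have "p a b \<le> censor p (Suc n) a b"
      using ab A(1) by (intro censor_ge[OF p irr n]) auto
    ultimately show ?thesis by (meson less_le_trans)
  qed
qed

text \<open>The two properties have to descend together: each elimination divides by a row sum whose
  positivity rests on both.\<close>

lemma red_p_invariant:
  assumes "stochastic_on N p" "no_closed_subset N p" "1 \<le> n" "n \<le> N"
  shows "stochastic_on n (red_p N p n) \<and> no_closed_subset n (red_p N p n)"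
  using assms(4,3)
proof (induction rule: inc_induct)
  case base
  then show ?case using assms red_p_top by metis
next
  case (step n)
  then show ?case
    using censor_stochastic censor_no_closed_subset red_p_step[of n N p] by (metis le_SucI)
qed

section \<open>Reduced data and back substitution\<close>

context
  fixes N :: nat and p :: "nat \<Rightarrow> nat \<Rightarrow> real" and \<mu> :: "nat \<Rightarrow> real"
  assumes p: "stochastic_on N p" and irr: "no_closed_subset N p"
begin

lemma red_row_sum_pos: "n \<in> {2..N} \<Longrightarrow> row_sum (red_p N p n) n > 0"
  using red_p_invariant[OF p irr, of n] row_sum_pos[of n "red_p N p n"] by auto

lemma red_p_nonneg:
  assumes "i \<in> {1..n}" "j \<in> {1..n}" "n \<le> N" shows "0 \<le> red_p N p n i j"
  using red_p_invariant[OF p irr, of n] assms unfolding stochastic_on_def by auto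

lemma red_mu_nonneg:
  assumes mu: "\<And>i. i \<in> {1..N} \<Longrightarrow> 0 \<le> \<mu> i" and "n \<le> N" "i \<in> {1..n}"
  shows "0 \<le> red_mu N p \<mu> n i"
  using assms(2,3)
proof (induction arbitrary: i rule: inc_induct)
  case base
  then show ?case using mu red_mu_top by metis
next
  case (step n)
  then have "row_sum (red_p N p (Suc n)) (Suc n) > 0" using red_row_sum_pos by auto
  moreover have "0 \<le> red_p N p (Suc n) i (Suc n)" using step by (intro red_p_nonneg) auto
  moreover have "0 \<le> red_mu N p \<mu> (Suc n) i" "0 \<le> red_mu N p \<mu> (Suc n) (Suc n)"
    using step by auto
  ultimately show ?case using step by (subst red_mu_step) auto
qed

text \<open>The clause for \<open>i = 2\<close> is the general clause with an empty sum, so one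
  recursion step covers all \<open>i \<ge> 2\<close>.\<close>

lemma passage_vec_step:
  assumes "n \<ge> 1"
  shows "passage_vec N p \<mu> (Suc n) =
    (red_mu N p \<mu> (Suc n) (Suc n) + (\<Sum>l=2..n. red_p N p (Suc n) (Suc n) l * passage_vec N p \<mu> l))
      / row_sum (red_p N p (Suc n)) (Suc n)"
  using assms by (subst passage_vec.simps) (auto simp: numeral_2_eq_2)

lemma passage_vec_nonneg:
  assumes mu: "\<And>i. i \<in> {1..N} \<Longrightarrow> 0 \<le> \<mu> i" and "i \<in> {1..N}"
  shows "0 \<le> passage_vec N p \<mu> i"
  using assms(2)
proof (induction i rule: less_induct)
  case (less i)
  show ?case
  proof (cases "i = 1")
    case True
    then show ?thesis using red_mu_nonneg[OF mu, of 1 1] less by (subst passage_vec.simps) auto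
  next
    case False
    then obtain n where n: "i = Suc n" "n \<ge> 1" using less by (cases i) auto
    have "row_sum (red_p N p i) i > 0" using less n by (intro red_row_sum_pos) auto
    moreover have "0 \<le> (\<Sum>l=2..n. red_p N p i i l * passage_vec N p \<mu> l)"
      using less n by (intro sum_nonneg mult_nonneg_nonneg red_p_nonneg less.IH) auto
    moreover have "0 \<le> red_mu N p \<mu> i i" using less by (intro red_mu_nonneg[OF mu]) auto
    ultimately show ?thesis using n passage_vec_step by auto
  qed
qed

text \<open>Eliminating the state \<open>n + 1\<close> turns the system on \<open>{1..n + 1}\<close> into the one on \<open>{1..n}\<close>;
  (iii) is the back substitution.\<close>

lemma passage_vec_reduced_system:
  assumes "1 \<le> n" "n \<le> N" "i \<in> {1..n}"
  shows "passage_vec N p \<mu> i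
    = red_mu N p \<mu> n i + (\<Sum>l=2..n. red_p N p n i l * passage_vec N p \<mu> l)"
  using assms
proof (induction n arbitrary: i rule: dec_induct)
  case base
  then show ?case by (subst passage_vec.simps) auto
next
  case (step n)
  let ?x = "passage_vec N p \<mu>" and ?p = "red_p N p (Suc n)" and ?m = "red_mu N p \<mu> (Suc n)"
  let ?S = "row_sum ?p (Suc n)"
  have S: "?S > 0" using step by (intro red_row_sum_pos) auto
  \<comment> \<open>This is (iii) with the denominator cleared.\<close>
  have xn: "?x (Suc n) * ?S = ?m (Suc n) + (\<Sum>l=2..n. ?p (Suc n) l * ?x l)"
    using S step by (subst passage_vec_step) auto
  have split: "(\<Sum>l=2..Suc n. f l) = (\<Sum>l=2..n. f l) + f (Suc n)" for f :: "nat \<Rightarrow> real"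
    using step by simp
  show ?case
  proof (cases "i = Suc n")
    case True
    \<comment> \<open>With the pivot in this form the diagonal term moves to the right-hand side and
      completes the sum up to \<open>Suc n\<close>.\<close>
    have "?S = 1 - ?p (Suc n) (Suc n)"
      using red_p_invariant[OF p irr, of "Suc n"] step by (intro row_sum_stochastic) auto
    then have "?x (Suc n) * ?S = ?x (Suc n) - ?p (Suc n) (Suc n) * ?x (Suc n)"
      by (simp only: right_diff_distrib mult_1_right mult.commute)
    then show ?thesis unfolding True split using xn by linarith
  next
    case False
    \<comment> \<open>The corrections from (i) and (ii) share this factor. Together they give
      \<open>?c * (?x (Suc n) * ?S)\<close>, the missing summand
      \<open>?p i (Suc n) * ?x (Suc n)\<close>.\<close>
    let ?c = "?p i (Suc n) / ?S"
    have "?x i = red_mu N p \<mu> n i + (\<Sum>l=2..n. red_p N p n i l * ?x l)"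
      using False step by auto
    also have "red_mu N p \<mu> n i = ?m i + ?c * ?m (Suc n)" using step by (intro red_mu_step) auto
    also have "(\<Sum>l=2..n. red_p N p n i l * ?x l)
        = (\<Sum>l=2..n. ?p i l * ?x l) + ?c * (\<Sum>l=2..n. ?p (Suc n) l * ?x l)"
    proof -
      have "red_p N p n i l = ?p i l + ?c * ?p (Suc n) l" for l
        using step by (subst red_p_step) (auto simp: censor_def)
      then show ?thesis by (simp only: distrib_right sum.distrib sum_distrib_left mult.assoc)
    qed
    also have "?m i + ?c * ?m (Suc n) + \<dots> = ?m i + (\<Sum>l=2..n. ?p i l * ?x l) + ?c * (?x (Suc n) * ?S)"
      unfolding xn by (simp only: distrib_left add.assoc add.left_commute add.commute)
    also have "\<dots> = ?m i + (\<Sum>l=2..Suc n. ?p i l * ?x l)"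
      unfolding split using S by simp
    finally show ?thesis .
  qed
qed

lemma passage_vec_system:
  assumes "i \<in> {1..N}"
  shows "passage_vec N p \<mu> i = \<mu> i + (\<Sum>l=2..N. p i l * passage_vec N p \<mu> l)"
  using passage_vec_reduced_system[of N i] assms by (simp add: red_p_top red_mu_top)

end

section \<open>Taboo powers\<close>

text \<open>An operator on functions, so that \<open>^^\<close> provides the matrix powers. Column
  \<open>k\<close> is removed but row \<open>k\<close> is kept, so \<open>i = k\<close> yields the
  mean recurrence time.\<close>

definition taboo :: "nat \<Rightarrow> (nat \<Rightarrow> nat \<Rightarrow> real) \<Rightarrow> nat \<Rightarrow> (nat \<Rightarrow> real) \<Rightarrow> nat \<Rightarrow> real" where
  "taboo N p k f i = (\<Sum>l\<in>{1..N} - {k}. p i l * f l)"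

lemma taboo_pow_nonneg:
  assumes p: "stochastic_on N p" and f: "\<And>i. i \<in> {1..N} \<Longrightarrow> 0 \<le> f i" and "i \<in> {1..N}"
  shows "0 \<le> (taboo N p k ^^ n) f i"
  using assms(3)
proof (induction n arbitrary: i)
  case (Suc n)
  then show ?case using p unfolding stochastic_on_def
    by (auto simp: taboo_def intro!: sum_nonneg mult_nonneg_nonneg)
qed (use f in auto)

lemma taboo_pow_mono:
  assumes p: "stochastic_on N p" and f: "\<And>i. i \<in> {1..N} \<Longrightarrow> f i \<le> g i" and "i \<in> {1..N}"
  shows "(taboo N p k ^^ n) f i \<le> (taboo N p k ^^ n) g i"
  using assms(3)
proof (induction n arbitrary: i)
  case (Suc n)
  then show ?case using p unfolding stochastic_on_def
    by (auto simp: taboo_def intro!: sum_mono mult_left_mono)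
qed (use f in auto)

lemma taboo_pow_scale: "(taboo N p k ^^ n) (\<lambda>l. c * f l) i = c * (taboo N p k ^^ n) f i"
proof (induction n arbitrary: i)
  case (Suc n)
  then show ?case by (auto simp: taboo_def sum_distrib_left mult_ac)
qed simp

lemma taboo_pow_Suc_right: "(taboo N p k ^^ Suc n) f = (taboo N p k ^^ n) (taboo N p k f)"
  by (simp add: funpow_swap1)

lemma taboo_iterate:
  assumes y: "\<And>i. i \<in> {1..N} \<Longrightarrow> y i = \<mu> i + taboo N p k y i" and "i \<in> {1..N}"
  shows "y i = (\<Sum>m<n. (taboo N p k ^^ m) \<mu> i) + (taboo N p k ^^ n) y i"
  using assms(2)
proof (induction n arbitrary: i)
  case (Suc n)
  have lin: "(taboo N p k ^^ n) (\<lambda>l. \<mu> l + taboo N p k y l) j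
      = (taboo N p k ^^ n) \<mu> j + (taboo N p k ^^ n) (taboo N p k y) j" for j
  proof (induction n arbitrary: j)
    case (Suc n)
    then show ?case by (simp add: taboo_def algebra_simps sum.distrib)
  qed simp
  \<comment> \<open>The equation for \<open>y\<close> is known on \<open>{1..N}\<close> only, hence
    is no equality of functions; \<open>taboo\<close> reads no other values.\<close>
  have cong: "(taboo N p k ^^ n) y j = (taboo N p k ^^ n) (\<lambda>l. \<mu> l + taboo N p k y l) j"
    if "j \<in> {1..N}" for j
    using that
  proof (induction n arbitrary: j)
    case (Suc n)
    then show ?case by (auto simp: taboo_def intro!: sum.cong)
  qed (use y in auto)
  show ?case using Suc cong lin taboo_pow_Suc_right[of n N p k y] by simp
qed simp

text \<open>By \<open>taboo_iterate\<close> the partial sums fall short of \<open>y i\<close> by a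
  nonnegative remainder.\<close>

lemma taboo_pow_summable:
  assumes p: "stochastic_on N p"
    and y: "\<And>i. i \<in> {1..N} \<Longrightarrow> y i = \<mu> i + taboo N p k y i"
    and y0: "\<And>i. i \<in> {1..N} \<Longrightarrow> 0 \<le> y i" and mu: "\<And>i. i \<in> {1..N} \<Longrightarrow> 0 \<le> \<mu> i"
    and i: "i \<in> {1..N}"
  shows "summable (\<lambda>n. (taboo N p k ^^ n) \<mu> i)"
proof (rule summableI_nonneg_bounded)
  show "0 \<le> (taboo N p k ^^ n) \<mu> i" for n using p mu i by (rule taboo_pow_nonneg)
  show "(\<Sum>m<n. (taboo N p k ^^ m) \<mu> i) \<le> y i" for n
  proof -
    have "y i = (\<Sum>m<n. (taboo N p k ^^ m) \<mu> i) + (taboo N p k ^^ n) y i"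
      using y i by (rule taboo_iterate)
    moreover have "0 \<le> (taboo N p k ^^ n) y i" using p y0 i by (rule taboo_pow_nonneg)
    ultimately show ?thesis by linarith
  qed
qed

text \<open>The remainder in \<open>taboo_iterate\<close> is squeezed between 0 and a constant
  multiple of the null sequence.\<close>

lemma nonneg_solution_sums:
  assumes p: "stochastic_on N p"
    and y: "\<And>i. i \<in> {1..N} \<Longrightarrow> y i = \<mu> i + taboo N p k y i"
    and y0: "\<And>i. i \<in> {1..N} \<Longrightarrow> 0 \<le> y i"
    and null: "(\<lambda>n. (taboo N p k ^^ n) (\<lambda>_. 1) i) \<longlonglongrightarrow> 0"
    and i: "i \<in> {1..N}"
  shows "(\<lambda>n. (taboo N p k ^^ n) \<mu> i) sums y i"
proof -
  define c where "c = (\<Sum>l=1..N. y l)"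
  \<comment> \<open>The factor \<open>1\<close> is kept so that \<open>taboo_pow_scale\<close> can
    pull out \<open>c\<close>.\<close>
  have le: "y l \<le> c * 1" if "l \<in> {1..N}" for l
    unfolding c_def using member_le_sum[of l "{1..N}" y] y0 that by auto
  have up: "(taboo N p k ^^ n) y i \<le> c * (taboo N p k ^^ n) (\<lambda>_. 1) i" for n
    using taboo_pow_mono[where f = y and g = "\<lambda>_. c * 1", OF p le i]
    by (simp only: taboo_pow_scale)
  have lo: "0 \<le> (taboo N p k ^^ n) y i" for n using p y0 i by (rule taboo_pow_nonneg)
  have "(\<lambda>n. c * (taboo N p k ^^ n) (\<lambda>_. 1) i) \<longlonglongrightarrow> 0"
    using tendsto_mult_right_zero[OF null] .
  then have "(\<lambda>n. (taboo N p k ^^ n) y i) \<longlonglongrightarrow> 0"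
    by (rule tendsto_sandwich[rotated -1]) (auto simp: lo up[simplified])
  then have "(\<lambda>n. y i - (taboo N p k ^^ n) y i) \<longlonglongrightarrow> y i - 0"
    by (rule tendsto_diff[OF tendsto_const])
  moreover have "y i - (taboo N p k ^^ n) y i = (\<Sum>m<n. (taboo N p k ^^ m) \<mu> i)" for n
    using taboo_iterate[where y = y, OF y i, of n] by linarith
  ultimately show ?thesis unfolding sums_def by simp
qed

section \<open>First passage in a Markov renewal process\<close>

text \<open>Continuity from below along the integers, extended to real \<open>t\<close> by
  monotonicity. It serves to let \<open>t\<close> tend to infinity in the kernel.\<close>

lemma (in finite_measure) measure_le_at_top:
  assumes f[measurable]: "f \<in> borel_measurable M" and G[measurable]: "G \<in> sets M"
  shows "((\<lambda>t::real. measure M (G \<inter> {\<omega> \<in> space M. f \<omega> \<le> t})) \<longlongrightarrow> measure M G) at_top"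
proof (rule tendsto_at_topI_sequentially_real)
  show "mono (\<lambda>t. measure M (G \<inter> {\<omega> \<in> space M. f \<omega> \<le> t}))"
    by (intro monoI finite_measure_mono) auto
  have "(\<lambda>n. measure M (G \<inter> {\<omega> \<in> space M. f \<omega> \<le> real n}))
      \<longlonglongrightarrow> measure M (\<Union>n. G \<inter> {\<omega> \<in> space M. f \<omega> \<le> real n})"
    by (rule finite_Lim_measure_incseq) (auto simp: incseq_def)
  moreover have "(\<Union>n. G \<inter> {\<omega> \<in> space M. f \<omega> \<le> real n}) = G"
    using sets.sets_into_space[OF G] by (auto simp: real_arch_simple)
  ultimately show "(\<lambda>n. measure M (G \<inter> {\<omega> \<in> space M. f \<omega> \<le> real n})) \<longlonglongrightarrow> measure M G"
    by simp
qed

text \<open>\<open>expect_from\<close> uses elementary conditioning on the initial state, so each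
  state needs positive initial probability. The first step then determines every row of the
  transition matrix.\<close>

locale started_markov_renewal_process = markov_renewal_process +
  assumes start: "\<And>i. i \<in> {1..N} \<Longrightarrow> 0 < prob {\<omega> \<in> space M. X 0 \<omega> = i}"
begin

abbreviation "state n l \<equiv> {\<omega> \<in> space M. X n \<omega> = l}"

abbreviation "holding n \<omega> \<equiv> T (Suc n) \<omega> - T n \<omega>"

abbreviation "p \<equiv> transition_prob Q"

declare X_measurable[measurable] T_measurable[measurable]

section \<open>Markov property with respect to the history\<close>

lemma history_subalgebra: "subalgebra M (history M X T n)"
proof -
  let ?G = "(\<Union>l\<in>{..n}. {X l -` A \<inter> space M | A. True}) \<union>
      (\<Union>l\<in>{..n}. {T l -` B \<inter> space M | B. B \<in> sets borel})"
  have "?G \<subseteq> sets M"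
    by (auto intro!: measurable_sets[OF X_measurable] measurable_sets[OF T_measurable])
  moreover from this have "?G \<subseteq> Pow (space M)" using sets.sets_into_space by blast
  ultimately show ?thesis
    unfolding subalgebra_def history_def
    by (simp only: space_measure_of sets_measure_of sets.sigma_sets_subset simp_thms)
qed

lemma history_sets: "G \<in> sets (history M X T n) \<Longrightarrow> G \<in> sets M"
  using history_subalgebra unfolding subalgebra_def by auto

lemma state_in_history:
  assumes "m \<le> n" shows "{\<omega> \<in> space M. R (X m \<omega>)} \<in> sets (history M X T n)"
proof -
  let ?G = "(\<Union>l\<in>{..n}. {X l -` A \<inter> space M | A. True}) \<union>
      (\<Union>l\<in>{..n}. {T l -` B \<inter> space M | B. B \<in> sets borel})"
  have "?G \<subseteq> Pow (space M)" by auto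
  moreover have "{\<omega> \<in> space M. R (X m \<omega>)} = X m -` Collect R \<inter> space M" by auto
  then have "{\<omega> \<in> space M. R (X m \<omega>)} \<in> ?G" using assms by blast
  ultimately show ?thesis unfolding history_def by (simp only: sets_measure_of sigma_sets.Basic)
qed

text \<open>Integrating the conditional probability over \<open>G\<close> gives the left side, since
  \<open>G\<close> belongs to the history; on \<open>G\<close> the integrand is almost surely the
  constant \<open>Q l j t\<close>.\<close>

lemma prob_history_kernel:
  assumes G: "G \<in> sets (history M X T n)" "G \<subseteq> state n l" and j: "j \<in> {1..N}"
  shows "prob (G \<inter> {\<omega> \<in> space M. X (Suc n) \<omega> = j \<and> holding n \<omega> \<le> t}) = prob G * Q l j t"
proof -
  let ?F = "history M X T n" and ?E = "{\<omega> \<in> space M. X (Suc n) \<omega> = j \<and> holding n \<omega> \<le> t}"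
  interpret F: sigma_finite_subalgebra M ?F
    by (intro finite_measure_subalgebra_is_sigma_finite)
      (simp add: finite_measure_subalgebra_def finite_measure_subalgebra_axioms_def
        history_subalgebra finite_measure_axioms)
  have GM[measurable]: "G \<in> sets M" using G history_sets by blast
  have E[measurable]: "?E \<in> sets M" by measurable
  have "prob (G \<inter> ?E) = (LINT \<omega>:G|M. indicator ?E \<omega>)"
    unfolding set_lebesgue_integral_def
    by (simp flip: indicator_inter_arith add: Int_absorb2 sets.sets_into_space)
  also have "\<dots> = (LINT \<omega>:G|M. real_cond_exp M ?F (indicator ?E) \<omega>)"
    using G(1) by (intro F.real_cond_exp_intA integrable_real_indicator)
      (auto simp: emeasure_eq_measure)
  also have "\<dots> = (LINT \<omega>:G|M. Q l j t)"
    unfolding set_lebesgue_integral_def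
  proof (rule integral_cong_AE)
    show "AE \<omega> in M. indicator G \<omega> *\<^sub>R real_cond_exp M ?F (indicator ?E) \<omega>
        = indicator G \<omega> *\<^sub>R Q l j t"
      using markov_renewal[OF j, of n t]
    proof eventually_elim
      case (elim \<omega>)
      have "\<omega> \<in> G \<Longrightarrow> X n \<omega> = l" using G(2) by blast
      with elim show ?case by (cases "\<omega> \<in> G") simp_all
    qed
  qed auto
  also have "\<dots> = prob G * Q l j t"
    unfolding set_lebesgue_integral_def by (simp add: sets.sets_into_space Int_absorb2)
  finally show ?thesis .
qed

text \<open>The factor \<open>prob G\<close> stays inside the limit, so null events \<open>G\<close>
  are covered too.\<close>

lemma kernel_at_top:
  assumes G: "G \<in> sets (history M X T n)" "G \<subseteq> state n l" and j: "j \<in> {1..N}"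
  shows "((\<lambda>t. prob G * Q l j t) \<longlongrightarrow> prob (G \<inter> state (Suc n) j)) at_top"
proof -
  have [measurable]: "G \<in> sets M" using G history_sets by blast
  have "((\<lambda>t. prob ((G \<inter> state (Suc n) j) \<inter> {\<omega> \<in> space M. holding n \<omega> \<le> t}))
      \<longlongrightarrow> prob (G \<inter> state (Suc n) j)) at_top"
    by (rule measure_le_at_top) auto
  moreover have "(G \<inter> state (Suc n) j) \<inter> {\<omega> \<in> space M. holding n \<omega> \<le> t}
      = G \<inter> {\<omega> \<in> space M. X (Suc n) \<omega> = j \<and> holding n \<omega> \<le> t}" for t by auto
  ultimately show ?thesis using prob_history_kernel[OF assms] by simp
qed

text \<open>\<open>transition_prob\<close> is a \<open>Lim\<close>, which is informative only once
  convergence is known. It follows by dividing by the positive probability of starting in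
  \<open>l\<close>.\<close>

lemma kernel_tendsto_transition_prob:
  assumes l: "l \<in> {1..N}" and j: "j \<in> {1..N}"
  shows "(Q l j \<longlongrightarrow> p l j) at_top"
proof -
  have "((\<lambda>t. prob (state 0 l) * Q l j t / prob (state 0 l))
      \<longlongrightarrow> prob (state 0 l \<inter> state (Suc 0) j) / prob (state 0 l)) at_top"
    using l by (intro tendsto_divide tendsto_const kernel_at_top state_in_history j)
      (use start[OF l] in auto)
  then have "(Q l j \<longlongrightarrow> prob (state 0 l \<inter> state (Suc 0) j) / prob (state 0 l)) at_top"
    using start[OF l] by simp
  then show ?thesis unfolding transition_prob_def by (simp add: tendsto_Lim)
qed

text \<open>The Markov property of the embedded chain: the limit of \<open>prob G * Q l j t\<close>
  is computed in two ways.\<close>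

lemma prob_history_transition:
  assumes G: "G \<in> sets (history M X T n)" "G \<subseteq> state n l"
    and l: "l \<in> {1..N}" and j: "j \<in> {1..N}"
  shows "prob (G \<inter> state (Suc n) j) = prob G * p l j"
  using kernel_at_top[OF G j] tendsto_mult_left[OF kernel_tendsto_transition_prob[OF l j]]
  by (rule tendsto_unique[OF trivial_limit_at_top_linorder])

lemma prob_decompose_state:
  assumes [measurable]: "G \<in> sets M"
  shows "prob G = (\<Sum>l=1..N. prob (G \<inter> state n l))"
proof -
  have "prob (\<Union>l\<in>{1..N}. G \<inter> state n l) = (\<Sum>l=1..N. prob (G \<inter> state n l))"
    by (rule finite_measure_finite_Union) (auto simp: disjoint_family_on_def)
  moreover have "(\<Union>l\<in>{1..N}. G \<inter> state n l) = G"
    using X_range[of _ n] sets.sets_into_space[OF assms] by auto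
  ultimately show ?thesis by simp
qed

lemma transition_prob_stochastic: "stochastic_on N p"
  unfolding stochastic_on_def
proof (intro ballI conjI)
  fix i assume i: "i \<in> {1..N}"
  have eq: "prob (state 0 i \<inter> state (Suc 0) j) = prob (state 0 i) * p i j" if "j \<in> {1..N}" for j
    using i that by (intro prob_history_transition state_in_history) auto
  show "0 \<le> p i j" if "j \<in> {1..N}" for j
  proof -
    have "0 \<le> prob (state 0 i) * p i j" unfolding eq[OF that, symmetric] by simp
    then show ?thesis using start[OF i] by (simp add: zero_le_mult_iff)
  qed
  have "prob (state 0 i) = (\<Sum>j=1..N. prob (state 0 i \<inter> state (Suc 0) j))"
    by (rule prob_decompose_state) auto
  also have "\<dots> = prob (state 0 i) * (\<Sum>j=1..N. p i j)"
    unfolding sum_distrib_left by (intro sum.cong refl eq)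
  finally show "(\<Sum>j=1..N. p i j) = 1" using start[OF i] by simp
qed

section \<open>Law and mean of the holding times\<close>

lemma prob_history_holding_le:
  assumes G: "G \<in> sets (history M X T n)" "G \<subseteq> state n l"
  shows "prob (G \<inter> {\<omega> \<in> space M. holding n \<omega> \<le> t}) = prob G * (\<Sum>j=1..N. Q l j t)"
proof -
  have [measurable]: "G \<in> sets M" using G history_sets by blast
  have "prob (G \<inter> {\<omega> \<in> space M. holding n \<omega> \<le> t})
      = (\<Sum>j=1..N. prob ((G \<inter> {\<omega> \<in> space M. holding n \<omega> \<le> t}) \<inter> state (Suc n) j))"
    by (rule prob_decompose_state) auto
  also have "\<dots> = (\<Sum>j=1..N. prob (G \<inter> {\<omega> \<in> space M. X (Suc n) \<omega> = j \<and> holding n \<omega> \<le> t}))"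
    by (intro sum.cong refl arg_cong[where f = prob]) auto
  also have "\<dots> = prob G * (\<Sum>j=1..N. Q l j t)"
    unfolding sum_distrib_left by (intro sum.cong refl prob_history_kernel G)
  finally show ?thesis .
qed

text \<open>Both laws have the distribution function \<open>\<Sum>j=1..N. Q l j t\<close>. This
  carries the mean holding time, defined through step 0, over to step \<open>n\<close> under any
  history event.\<close>

lemma holding_distribution:
  assumes G: "G \<in> sets (history M X T n)" "G \<subseteq> state n l"
    and l: "l \<in> {1..N}" and pos: "prob G > 0"
  shows "distr (uniform_measure M G) borel (holding n)
    = distr (uniform_measure M (state 0 l)) borel (holding 0)"
proof -
  \<comment> \<open>Stated for general \<open>H\<close> and \<open>m\<close> because it is used for
    \<open>G\<close> at time \<open>n\<close> and for the initial event at time 0.\<close>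
  have cdf_eq: "cdf (distr (uniform_measure M H) borel (holding m)) t = (\<Sum>j=1..N. Q l j t)
      \<and> real_distribution (distr (uniform_measure M H) borel (holding m))"
    if H: "H \<in> sets (history M X T m)" "H \<subseteq> state m l" and pos: "prob H > 0" for H m t
  proof
    have [measurable]: "H \<in> sets M" using H history_sets by blast
    have emeasure: "emeasure M H \<noteq> 0" "emeasure M H \<noteq> \<infinity>"
      using pos by (auto simp: emeasure_eq_measure)
    interpret U: prob_space "uniform_measure M H"
      using emeasure by (rule prob_space_uniform_measure)
    show "real_distribution (distr (uniform_measure M H) borel (holding m))"
      by (rule U.real_distribution_distr) measurable
    have "cdf (distr (uniform_measure M H) borel (holding m)) t
        = measure (uniform_measure M H) {\<omega> \<in> space M. holding m \<omega> \<le> t}"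
      unfolding cdf_def by (subst measure_distr) (auto intro!: arg_cong2[where f = measure])
    also have "\<dots> = prob (H \<inter> {\<omega> \<in> space M. holding m \<omega> \<le> t}) / prob H"
      using emeasure by (intro measure_uniform_measure) auto
    also have "\<dots> = (\<Sum>j=1..N. Q l j t)"
      using prob_history_holding_le[OF H] pos by simp
    finally show "cdf (distr (uniform_measure M H) borel (holding m)) t = (\<Sum>j=1..N. Q l j t)" .
  qed
  have start': "state 0 l \<in> sets (history M X T 0)" by (rule state_in_history) simp
  show ?thesis
    using cdf_eq[OF G pos] cdf_eq[OF start' order_refl start[OF l]]
    by (intro cdf_unique ext) auto
qed

lemma nn_integral_history_holding:
  assumes G: "G \<in> sets (history M X T n)" "G \<subseteq> state n l" and l: "l \<in> {1..N}"
  shows "(\<integral>\<^sup>+\<omega>\<in>G. ennreal (holding n \<omega>) \<partial>M) = ennreal (prob G) * mean_holding_time M X T l"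
proof (cases "prob G = 0")
  \<comment> \<open>A null event cannot be conditioned on. Both sides vanish, the right one even for
    an infinite mean because 0 times \<open>\<infinity>\<close> is 0 in
    \<open>ennreal\<close>.\<close>
  case True
  have "G \<in> sets M" using G history_sets by blast
  then have "G \<in> null_sets M" using True by (auto simp: emeasure_eq_measure intro: null_setsI)
  then show ?thesis using True by (simp add: nn_integral_null_set)
next
  case False
  then have pos: "prob G > 0" by (simp add: less_le)
  have [measurable]: "G \<in> sets M" using G history_sets by blast
  have "(\<integral>\<^sup>+\<omega>\<in>G. ennreal (holding n \<omega>) \<partial>M) / emeasure M G
      = (\<integral>\<^sup>+\<omega>. ennreal (holding n \<omega>) \<partial>uniform_measure M G)"
    by (subst nn_integral_uniform_measure) auto
  also have "\<dots> = (\<integral>\<^sup>+x. ennreal x \<partial>distr (uniform_measure M G) borel (holding n))"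
    by (subst nn_integral_distr) auto
  also have "\<dots> = (\<integral>\<^sup>+\<omega>. ennreal (holding 0 \<omega>) \<partial>uniform_measure M (state 0 l))"
    unfolding holding_distribution[OF G l pos] by (subst nn_integral_distr) auto
  also have "\<dots> = mean_holding_time M X T l"
    by (simp add: mean_holding_time_def expect_from_def)
  finally have "emeasure M G * mean_holding_time M X T l
      = emeasure M G * ((\<integral>\<^sup>+\<omega>\<in>G. ennreal (holding n \<omega>) \<partial>M) / emeasure M G)" by simp
  also have "\<dots> = (\<integral>\<^sup>+\<omega>\<in>G. ennreal (holding n \<omega>) \<partial>M)"
    unfolding ennreal_times_divide mult.commute[of "emeasure M G"]
    using pos by (intro mult_divide_eq_ennreal) (auto simp: emeasure_eq_measure)
  finally show ?thesis by (simp add: emeasure_eq_measure)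
qed

text \<open>The event that the process starts in \<open>i\<close> and \<kappa> exceeds
  \<open>n\<close>. Times are counted from 1, so starting in \<open>k\<close> itself is
  allowed.\<close>

definition avoiding :: "nat \<Rightarrow> nat \<Rightarrow> nat \<Rightarrow> 'a set" where
  "avoiding i k n = {\<omega> \<in> space M. X 0 \<omega> = i \<and> (\<forall>m\<in>{1..n}. X m \<omega> \<noteq> k)}"

lemma avoiding_Suc: "avoiding i k (Suc n) = avoiding i k n \<inter> {\<omega> \<in> space M. X (Suc n) \<omega> \<noteq> k}"
  unfolding avoiding_def by (auto simp: atLeastAtMostSuc_conv)

lemma avoiding_in_history: "m \<le> n \<Longrightarrow> avoiding i k m \<in> sets (history M X T n)"
proof (induction m)
  case 0
  then show ?case using state_in_history[of 0 n "\<lambda>x. x = i"] by (simp add: avoiding_def)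
next
  case (Suc m)
  then show ?case unfolding avoiding_Suc by (intro sets.Int state_in_history) auto
qed

lemma avoiding_sets[measurable]: "avoiding i k n \<in> sets M"
  using avoiding_in_history history_sets by blast

lemma avoiding_state_in_history: "avoiding i k n \<inter> state n l \<in> sets (history M X T n)"
  by (intro sets.Int avoiding_in_history state_in_history) auto

text \<open>The operator \<open>taboo\<close> acts on functions of the current state, so the induction peels off the
  last step and runs over all \<open>f\<close>.\<close>

lemma sum_avoiding_taboo:
  assumes i: "i \<in> {1..N}"
  shows "(\<Sum>l=1..N. prob (avoiding i k n \<inter> state n l) * f l)
    = prob (state 0 i) * (taboo N p k ^^ n) f i"
proof (induction n arbitrary: f)
  case 0
  have "prob (avoiding i k 0 \<inter> state 0 l) * f l = (if l = i then prob (state 0 i) * f i else 0)" for l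
  proof (cases "l = i")
    case True
    then have "avoiding i k 0 \<inter> state 0 l = state 0 i" by (auto simp: avoiding_def)
    then show ?thesis using True by simp
  next
    case False
    then have "avoiding i k 0 \<inter> state 0 l = {}" by (auto simp: avoiding_def)
    then show ?thesis using False by simp
  qed
  then show ?case using i by simp
next
  case (Suc n)
  let ?a = "\<lambda>l. prob (avoiding i k n \<inter> state n l)"
  \<comment> \<open>The term \<open>l = k\<close> therefore drops out, matching the deleted column
    of \<open>taboo\<close>.\<close>
  have k: "avoiding i k (Suc n) \<inter> state (Suc n) k = {}" by (auto simp: avoiding_Suc)
  have step: "prob (avoiding i k (Suc n) \<inter> state (Suc n) l) = (\<Sum>l'=1..N. ?a l' * p l' l)"
    if l: "l \<in> {1..N} - {k}" for l
  proof -
    have "avoiding i k (Suc n) \<inter> state (Suc n) l = avoiding i k n \<inter> state (Suc n) l"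
      using l by (auto simp: avoiding_Suc)
    then have "prob (avoiding i k (Suc n) \<inter> state (Suc n) l)
        = (\<Sum>l'=1..N. prob ((avoiding i k n \<inter> state (Suc n) l) \<inter> state n l'))"
      by (simp only:) (intro prob_decompose_state, measurable)
    also have "\<dots> = (\<Sum>l'=1..N. prob ((avoiding i k n \<inter> state n l') \<inter> state (Suc n) l))"
      by (intro sum.cong refl arg_cong[where f = prob]) auto
    also have "\<dots> = (\<Sum>l'=1..N. ?a l' * p l' l)"
      using l by (intro sum.cong refl prob_history_transition avoiding_state_in_history) auto
    finally show ?thesis .
  qed
  have "(\<Sum>l=1..N. prob (avoiding i k (Suc n) \<inter> state (Suc n) l) * f l)
      = (\<Sum>l\<in>{1..N} - {k}. prob (avoiding i k (Suc n) \<inter> state (Suc n) l) * f l)"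
    by (rule sum.mono_neutral_right) (use k in auto)
  also have "\<dots> = (\<Sum>l\<in>{1..N} - {k}. \<Sum>l'=1..N. ?a l' * p l' l * f l)"
    using step by (intro sum.cong) (auto simp: sum_distrib_right)
  also have "\<dots> = (\<Sum>l'=1..N. \<Sum>l\<in>{1..N} - {k}. ?a l' * p l' l * f l)"
    by (rule sum.swap)
  also have "\<dots> = (\<Sum>l'=1..N. ?a l' * taboo N p k f l')"
    by (simp add: taboo_def sum_distrib_left mult.assoc)
  also have "\<dots> = prob (state 0 i) * (taboo N p k ^^ Suc n) f i"
    unfolding taboo_pow_Suc_right by (rule Suc)
  finally show ?case .
qed

lemma prob_avoiding:
  assumes i: "i \<in> {1..N}"
  shows "prob (avoiding i k n) = prob (state 0 i) * (taboo N p k ^^ n) (\<lambda>_. 1) i"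
  using sum_avoiding_taboo[OF i, of k n "\<lambda>_. 1"] prob_decompose_state[of "avoiding i k n" n] by simp

text \<open>Split by the state \<open>l\<close> at time \<open>n\<close>: each part is a history
  event on which the holding time has mean \<mu> at \<open>l\<close>. Then
  \<open>sum_avoiding_taboo\<close> is used with these means as \<open>f\<close>.\<close>

lemma nn_integral_avoiding_holding:
  assumes i: "i \<in> {1..N}" and fin: "\<And>l. l \<in> {1..N} \<Longrightarrow> mean_holding_time M X T l < \<infinity>"
  shows "(\<integral>\<^sup>+\<omega>\<in>avoiding i k n. ennreal (holding n \<omega>) \<partial>M) = ennreal (prob (state 0 i)
    * (taboo N p k ^^ n) (\<lambda>l. enn2real (mean_holding_time M X T l)) i)"
proof -
  let ?B = "\<lambda>l. avoiding i k n \<inter> state n l"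
  let ?\<mu> = "\<lambda>l. enn2real (mean_holding_time M X T l)"
  have "(\<integral>\<^sup>+\<omega>\<in>avoiding i k n. ennreal (holding n \<omega>) \<partial>M)
      = (\<integral>\<^sup>+\<omega>. (\<Sum>l=1..N. ennreal (holding n \<omega>) * indicator (?B l) \<omega>) \<partial>M)"
  proof (rule nn_integral_cong)
    fix \<omega> assume \<omega>: "\<omega> \<in> space M"
    have eq: "(\<Sum>l=1..N. ennreal (holding n \<omega>) * indicator (?B l) \<omega>)
        = (\<Sum>l\<in>{X n \<omega>}. ennreal (holding n \<omega>) * indicator (?B l) \<omega>)"
      by (rule sum.mono_neutral_right) (use X_range[OF \<omega>, of n] in auto)
    show "ennreal (holding n \<omega>) * indicator (avoiding i k n) \<omega>
        = (\<Sum>l=1..N. ennreal (holding n \<omega>) * indicator (?B l) \<omega>)"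
      unfolding eq using \<omega> by (simp add: indicator_def)
  qed
  also have "\<dots> = (\<Sum>l=1..N. \<integral>\<^sup>+\<omega>\<in>?B l. ennreal (holding n \<omega>) \<partial>M)"
    by (rule nn_integral_sum) measurable
  also have "\<dots> = (\<Sum>l=1..N. ennreal (prob (?B l) * ?\<mu> l))"
  proof (rule sum.cong[OF refl])
    fix l assume l: "l \<in> {1..N}"
    have "(\<integral>\<^sup>+\<omega>\<in>?B l. ennreal (holding n \<omega>) \<partial>M) = ennreal (prob (?B l)) * mean_holding_time M X T l"
      using l by (intro nn_integral_history_holding avoiding_state_in_history) auto
    then show "(\<integral>\<^sup>+\<omega>\<in>?B l. ennreal (holding n \<omega>) \<partial>M) = ennreal (prob (?B l) * ?\<mu> l)"
      using fin[OF l] by (simp add: ennreal_mult)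
  qed
  also have "\<dots> = ennreal (\<Sum>l=1..N. prob (?B l) * ?\<mu> l)" by (rule sum_ennreal) simp
  finally show ?thesis unfolding sum_avoiding_taboo[OF i] .
qed

text \<open>The indicators cut the series off at \<kappa>, and the rest telescopes to
  \<open>T \<kappa> \<omega>\<close> as \<open>T 0 \<omega> = 0\<close>. The fixed index range lets
  sum and integral be interchanged later.\<close>

lemma first_passage_time_eq_suminf:
  assumes \<omega>: "\<omega> \<in> state 0 i" and hit: "\<exists>m\<ge>1. X m \<omega> = k"
  shows "first_passage_time X T k \<omega>
    = (\<Sum>n. ennreal (holding n \<omega>) * indicator (avoiding i k n) \<omega>)"
proof -
  define \<kappa> where "\<kappa> = (LEAST m. m \<ge> 1 \<and> X m \<omega> = k)"
  have \<kappa>: "\<kappa> \<ge> 1" "X \<kappa> \<omega> = k" using LeastI_ex[OF hit] by (auto simp: \<kappa>_def)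
  have before: "\<omega> \<in> avoiding i k n \<longleftrightarrow> n < \<kappa>" for n
  proof
    assume "\<omega> \<in> avoiding i k n"
    then show "n < \<kappa>" using \<kappa> unfolding avoiding_def by (auto simp: not_less[symmetric])
  next
    assume n: "n < \<kappa>"
    have "X m \<omega> \<noteq> k" if "m \<in> {1..n}" for m
    proof -
      have "m < \<kappa>" "m \<ge> 1" using n that by auto
      then show ?thesis using not_less_Least[of m "\<lambda>m. m \<ge> 1 \<and> X m \<omega> = k"]
        unfolding \<kappa>_def by blast
    qed
    then show "\<omega> \<in> avoiding i k n" using \<omega> unfolding avoiding_def by blast
  qed
  have "(\<Sum>n. ennreal (holding n \<omega>) * indicator (avoiding i k n) \<omega>)
      = (\<Sum>n<\<kappa>. ennreal (holding n \<omega>) * indicator (avoiding i k n) \<omega>)"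
    by (rule suminf_finite) (auto simp: before)
  also have "\<dots> = (\<Sum>n<\<kappa>. ennreal (holding n \<omega>))"
    by (rule sum.cong) (auto simp: before)
  also have "\<dots> = ennreal (\<Sum>n<\<kappa>. holding n \<omega>)"
    using T_mono \<omega> by (intro sum_ennreal) auto
  also have "\<dots> = ennreal (T \<kappa> \<omega>)"
    using T_0 \<omega> sum_lessThan_telescope[of "\<lambda>n. T n \<omega>" \<kappa>] by simp
  finally show ?thesis using hit unfolding first_passage_time_def \<kappa>_def by simp
qed

text \<open>Paths that never reach \<open>k\<close> have infinite passage time but form a null set
  by \<open>null\<close>; off it the series of holding times is integrated term by term.\<close>

lemma mean_first_passage_time_eq:
  assumes i: "i \<in> {1..N}" and fin: "\<And>l. l \<in> {1..N} \<Longrightarrow> mean_holding_time M X T l < \<infinity>"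
    and null: "(\<lambda>n. (taboo N p k ^^ n) (\<lambda>_. 1) i) \<longlonglongrightarrow> 0"
    and y: "(\<lambda>n. (taboo N p k ^^ n) (\<lambda>l. enn2real (mean_holding_time M X T l)) i) sums y"
  shows "mean_first_passage_time M X T i k = ennreal y"
proof -
  let ?\<mu> = "\<lambda>l. enn2real (mean_holding_time M X T l)"
  let ?S = "state 0 i"
  have never: "(\<Inter>n. avoiding i k n) \<in> null_sets M"
  proof -
    have "(\<lambda>n. prob ?S * (taboo N p k ^^ n) (\<lambda>_. 1) i) \<longlonglongrightarrow> 0"
      using null by (rule tendsto_mult_right_zero)
    \<comment> \<open>The intersection lies in every \<open>avoiding i k n\<close>, whose
      probabilities tend to 0.\<close>
    then have "prob (\<Inter>n. avoiding i k n) \<le> 0"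
    proof (rule LIMSEQ_le_const, intro exI allI impI)
      fix n
      have "prob (\<Inter>n. avoiding i k n) \<le> prob (avoiding i k n)"
        by (rule finite_measure_mono) auto
      then show "prob (\<Inter>n. avoiding i k n) \<le> prob ?S * (taboo N p k ^^ n) (\<lambda>_. 1) i"
        using prob_avoiding[OF i] by simp
    qed
    then have "prob (\<Inter>n. avoiding i k n) = 0" by (simp add: measure_le_0_iff)
    then show ?thesis by (intro null_setsI) (auto simp: emeasure_eq_measure)
  qed
  have nonneg: "0 \<le> (taboo N p k ^^ n) ?\<mu> i" for n
    using i by (intro taboo_pow_nonneg transition_prob_stochastic) auto
  have AE: "AE \<omega> in uniform_measure M ?S. first_passage_time X T k \<omega>
      = (\<Sum>n. ennreal (holding n \<omega>) * indicator (avoiding i k n) \<omega>)"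
  proof (rule AE_uniform_measureI)
    show "AE \<omega> in M. \<omega> \<in> ?S \<longrightarrow> first_passage_time X T k \<omega>
      = (\<Sum>n. ennreal (holding n \<omega>) * indicator (avoiding i k n) \<omega>)"
      using AE_not_in[OF never]
    proof eventually_elim
      case (elim \<omega>)
      show ?case
      proof
        assume \<omega>: "\<omega> \<in> ?S"
        with elim have "\<exists>m\<ge>1. X m \<omega> = k" by (auto simp: avoiding_def)
        then show "first_passage_time X T k \<omega>
            = (\<Sum>n. ennreal (holding n \<omega>) * indicator (avoiding i k n) \<omega>)"
          by (rule first_passage_time_eq_suminf[OF \<omega>])
      qed
    qed
  qed measurable
  have summand: "(\<integral>\<^sup>+\<omega>. ennreal (holding n \<omega>) * indicator (avoiding i k n) \<omega> \<partial>uniform_measure M ?S)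
      = ennreal ((taboo N p k ^^ n) ?\<mu> i)" for n
  proof -
    have "(\<integral>\<^sup>+\<omega>. ennreal (holding n \<omega>) * indicator (avoiding i k n) \<omega> \<partial>uniform_measure M ?S)
        = (\<integral>\<^sup>+\<omega>. ennreal (holding n \<omega>) * indicator (avoiding i k n) \<omega> * indicator ?S \<omega> \<partial>M) / emeasure M ?S"
      by (rule nn_integral_uniform_measure) measurable
    also have "(\<integral>\<^sup>+\<omega>. ennreal (holding n \<omega>) * indicator (avoiding i k n) \<omega> * indicator ?S \<omega> \<partial>M)
        = (\<integral>\<^sup>+\<omega>\<in>avoiding i k n. ennreal (holding n \<omega>) \<partial>M)"
      by (rule nn_integral_cong) (auto simp: avoiding_def split: split_indicator)
    also have "\<dots> = ennreal (prob ?S * (taboo N p k ^^ n) ?\<mu> i)"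
      using i fin by (rule nn_integral_avoiding_holding)
    also have "\<dots> / emeasure M ?S
        = ennreal (prob ?S * (taboo N p k ^^ n) ?\<mu> i / prob ?S)"
      unfolding emeasure_eq_measure
      using start[OF i] nonneg by (intro divide_ennreal) auto
    finally show ?thesis using start[OF i] by simp
  qed
  have "mean_first_passage_time M X T i k
      = (\<integral>\<^sup>+\<omega>. (\<Sum>n. ennreal (holding n \<omega>) * indicator (avoiding i k n) \<omega>) \<partial>uniform_measure M ?S)"
    unfolding mean_first_passage_time_def expect_from_def by (rule nn_integral_cong_AE[OF AE])
  also have "\<dots> = (\<Sum>n. ennreal ((taboo N p k ^^ n) ?\<mu> i))"
    unfolding summand[symmetric] by (rule nn_integral_suminf) measurable
  also have "\<dots> = ennreal y"
    using nonneg y by (rule suminf_ennreal_eq)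
  finally show ?thesis .
qed

end

section \<open>Cyclic relabelling\<close>

text \<open>As \<open>a + k - 2 < 2 * N\<close>, the \<open>mod\<close> wraps around at most once;
  the case form leaves linear arithmetic.\<close>

lemma cyc_eq:
  assumes "k \<in> {1..N}" "a \<in> {1..N}"
  shows "cyc N k a = (if a + k \<le> N + 1 then a + k - 1 else a + k - 1 - N)"
proof (cases "a + k \<le> N + 1")
  case True
  then show ?thesis using assms by (auto simp: cyc_def)
next
  case False
  then have "a + k - 2 = (a + k - 2 - N) + N" "a + k - 2 - N < N" using assms by auto
  then have "(a + k - 2) mod N = a + k - 2 - N" by (metis mod_add_self2 mod_less)
  then show ?thesis using assms False by (auto simp: cyc_def)
qed

lemma cyc_one: "k \<in> {1..N} \<Longrightarrow> cyc N k 1 = k"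
  by (subst cyc_eq) auto

lemma cyc_bij: "k \<in> {1..N} \<Longrightarrow> bij_betw (cyc N k) {1..N} {1..N}"
proof -
  assume k: "k \<in> {1..N}"
  have "inj_on (cyc N k) {1..N}"
    by (rule inj_onI) (use k in \<open>auto simp: cyc_eq split: if_splits\<close>)
  moreover have "cyc N k ` {1..N} \<subseteq> {1..N}"
    using k by (auto simp: cyc_eq)
  ultimately show ?thesis
    by (simp add: bij_betw_def endo_inj_surj)
qed

text \<open>The explicit inverse of \<open>cyc N k\<close>: it locates the entry for state
  \<open>i\<close> in the \<open>k\<close>-th vector.\<close>

lemma cyc_index:
  assumes "i \<in> {1..N}" "k \<in> {1..N}"
  shows "(i + N - k) mod N + 1 \<in> {1..N}" "cyc N k ((i + N - k) mod N + 1) = i"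
proof -
  show range: "(i + N - k) mod N + 1 \<in> {1..N}" using assms by (auto simp: Suc_leI)
  have "(i + N - k) mod N = (if i < k then i + N - k else i - k)"
    using assms by (auto simp: not_less mod_if)
  then show "cyc N k ((i + N - k) mod N + 1) = i"
    unfolding cyc_eq[OF assms(2) range] using assms by auto
qed

lemma map_cyc_upt: "k \<in> {1..N} \<Longrightarrow> map (cyc N k) [1..<N+1] = [k..<N+1] @ [1..<k]"
  by (rule nth_equalityI) (auto simp: nth_append cyc_eq)

lemma stochastic_on_relabel:
  assumes p: "stochastic_on N p" and \<sigma>: "bij_betw \<sigma> {1..N} {1..N}"
  shows "stochastic_on N (\<lambda>a b. p (\<sigma> a) (\<sigma> b))"
  unfolding stochastic_on_def
proof (intro ballI conjI)
  fix a assume a: "a \<in> {1..N}"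
  then have \<sigma>a: "\<sigma> a \<in> {1..N}" using \<sigma> bij_betwE by blast
  show "0 \<le> p (\<sigma> a) (\<sigma> b)" if "b \<in> {1..N}" for b
    using \<sigma> bij_betwE \<sigma>a that p unfolding stochastic_on_def by blast
  show "(\<Sum>b=1..N. p (\<sigma> a) (\<sigma> b)) = 1"
    using sum.reindex_bij_betw[OF \<sigma>, of "p (\<sigma> a)"] p \<sigma>a unfolding stochastic_on_def by simp
qed

lemma no_closed_subset_relabel:
  assumes irr: "no_closed_subset N p" and \<sigma>: "bij_betw \<sigma> {1..N} {1..N}"
  shows "no_closed_subset N (\<lambda>a b. p (\<sigma> a) (\<sigma> b))"
  unfolding no_closed_subset_def
proof (intro allI impI)
  fix A assume A: "A \<subset> {1..N}" "A \<noteq> {}"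
  have inj: "inj_on \<sigma> {1..N}" and surj: "\<sigma> ` {1..N} = {1..N}" using \<sigma> by (auto simp: bij_betw_def)
  have "\<sigma> ` A \<subset> \<sigma> ` {1..N}" using inj A(1) by (rule image_strict_mono)
  then obtain i j where ij: "i \<in> \<sigma> ` A" "j \<in> {1..N} - \<sigma> ` A" "0 < p i j"
    using irr A(2) unfolding no_closed_subset_def surj by (metis image_is_empty)
  obtain a where a: "a \<in> A" "i = \<sigma> a" using ij(1) by blast
  obtain b where b: "b \<in> {1..N}" "j = \<sigma> b" using ij(2) surj by blast
  have "b \<notin> A" using b ij(2) by blast
  with a b ij(3) show "\<exists>a\<in>A. \<exists>b\<in>{1..N} - A. 0 < p (\<sigma> a) (\<sigma> b)" by blast
qed

text \<open>The recursion always has state 1 as its target. Carrying its output back along \<sigma>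
  turns the deleted column 1 into the deleted column \<open>k\<close>.\<close>

lemma passage_vec_relabelled_solution:
  fixes \<mu> :: "nat \<Rightarrow> real"
  assumes p: "stochastic_on N p" and irr: "no_closed_subset N p"
    and \<sigma>: "bij_betw \<sigma> {1..N} {1..N}" and k: "\<sigma> 1 = k" and N: "N \<ge> 1"
    and mu: "\<And>i. i \<in> {1..N} \<Longrightarrow> 0 \<le> \<mu> i"
  obtains y where "\<And>i. i \<in> {1..N} \<Longrightarrow> 0 \<le> y i"
    and "\<And>i. i \<in> {1..N} \<Longrightarrow> y i = \<mu> i + taboo N p k y i"
    and "\<And>a. a \<in> {1..N} \<Longrightarrow>
      y (\<sigma> a) = passage_vec N (\<lambda>a b. p (\<sigma> a) (\<sigma> b)) (\<lambda>a. \<mu> (\<sigma> a)) a"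
proof -
  let ?x = "passage_vec N (\<lambda>a b. p (\<sigma> a) (\<sigma> b)) (\<lambda>a. \<mu> (\<sigma> a))"
  define y where "y i = ?x (inv_into {1..N} \<sigma> i)" for i
  have inj: "inj_on \<sigma> {1..N}" and surj: "\<sigma> ` {1..N} = {1..N}" using \<sigma> by (auto simp: bij_betw_def)
  have y: "y (\<sigma> a) = ?x a" if "a \<in> {1..N}" for a
    unfolding y_def using inv_into_f_f[OF inj that] by simp
  have \<sigma>_range: "\<sigma> a \<in> {1..N}" if "a \<in> {1..N}" for a using \<sigma> that bij_betwE by blast
  note relabel = stochastic_on_relabel[OF p \<sigma>] no_closed_subset_relabel[OF irr \<sigma>]
  have "0 \<le> ?x a" if "a \<in> {1..N}" for a
    using relabel mu[OF \<sigma>_range] that by (rule passage_vec_nonneg)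
  then have nonneg: "0 \<le> y (\<sigma> a)" if "a \<in> {1..N}" for a using y that by simp
  have "{2..N} = {1..N} - {1}" by auto
  moreover have "\<sigma> ` ({1..N} - {1}) = {1..N} - {k}"
    using inj_on_image_set_diff[OF inj, of "{1..N}" "{1}"] N k surj by simp
  \<comment> \<open>This identifies the sum over \<open>{2..N}\<close> in the recursion with the one
    in \<open>taboo\<close>.\<close>
  ultimately have rest: "bij_betw \<sigma> {2..N} ({1..N} - {k})"
    using inj_on_subset[OF inj, of "{1..N} - {1}"] by (auto simp: bij_betw_def)
  have eq: "y (\<sigma> a) = \<mu> (\<sigma> a) + taboo N p k y (\<sigma> a)" if a: "a \<in> {1..N}" for a
  proof -
    have "taboo N p k y (\<sigma> a) = (\<Sum>l=2..N. p (\<sigma> a) (\<sigma> l) * y (\<sigma> l))"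
      unfolding taboo_def using sum.reindex_bij_betw[OF rest, of "\<lambda>l. p (\<sigma> a) l * y l"] by simp
    also have "\<dots> = (\<Sum>l=2..N. p (\<sigma> a) (\<sigma> l) * ?x l)"
      using y by (intro sum.cong) auto
    finally show ?thesis using passage_vec_system[OF relabel a] y[OF a] by simp
  qed
  have "\<exists>a\<in>{1..N}. i = \<sigma> a" if "i \<in> {1..N}" for i using surj that by blast
  then show ?thesis using nonneg eq y by (intro that[of y]) blast+
qed

section \<open>Mean first passage times as output of the recursion\<close>

context started_markov_renewal_process
begin

lemma mean_first_passage_time_passage_vec:
  assumes irr: "irreducible_chain N p"
    and fin: "\<And>i. i \<in> {1..N} \<Longrightarrow> mean_holding_time M X T i < \<infinity>"
    and \<sigma>: "bij_betw \<sigma> {1..N} {1..N}" "\<sigma> 1 = k" and N: "N \<ge> 1" and a: "a \<in> {1..N}"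
  shows "mean_first_passage_time M X T (\<sigma> a) k = ennreal (passage_vec N
      (\<lambda>a b. p (\<sigma> a) (\<sigma> b)) (\<lambda>a. enn2real (mean_holding_time M X T (\<sigma> a))) a)"
    and "0 \<le> passage_vec N
      (\<lambda>a b. p (\<sigma> a) (\<sigma> b)) (\<lambda>a. enn2real (mean_holding_time M X T (\<sigma> a))) a"
proof -
  let ?\<mu> = "\<lambda>i. enn2real (mean_holding_time M X T i)"
  note p = transition_prob_stochastic
  note closed = irreducible_no_closed_subset[OF p irr]
  have \<sigma>a: "\<sigma> a \<in> {1..N}" using \<sigma>(1) a bij_betwE by blast
  \<comment> \<open>The recursion is run first with unit holding times, the discrete-time case, only
    to show that the powers tend to 0.\<close>
  obtain z where z: "\<And>i. i \<in> {1..N} \<Longrightarrow> 0 \<le> z i"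
      "\<And>i. i \<in> {1..N} \<Longrightarrow> z i = 1 + taboo N p k z i"
    by (rule passage_vec_relabelled_solution[OF p closed \<sigma> N, of "\<lambda>_. 1"]) auto
  have "summable (\<lambda>n. (taboo N p k ^^ n) (\<lambda>_. 1) (\<sigma> a))"
    by (rule taboo_pow_summable[OF p z(2,1) _ \<sigma>a]) auto
  then have null: "(\<lambda>n. (taboo N p k ^^ n) (\<lambda>_. 1) (\<sigma> a)) \<longlonglongrightarrow> 0"
    by (rule summable_LIMSEQ_zero)
  obtain y where y: "\<And>i. i \<in> {1..N} \<Longrightarrow> 0 \<le> y i"
      "\<And>i. i \<in> {1..N} \<Longrightarrow> y i = ?\<mu> i + taboo N p k y i"
      "\<And>a. a \<in> {1..N} \<Longrightarrow>
        y (\<sigma> a) = passage_vec N (\<lambda>a b. p (\<sigma> a) (\<sigma> b)) (\<lambda>a. ?\<mu> (\<sigma> a)) a"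
    by (rule passage_vec_relabelled_solution[OF p closed \<sigma> N, of ?\<mu>]) auto
  have "(\<lambda>n. (taboo N p k ^^ n) ?\<mu> (\<sigma> a)) sums y (\<sigma> a)"
    using p y(2,1) null \<sigma>a by (rule nonneg_solution_sums)
  with \<sigma>a fin null have "mean_first_passage_time M X T (\<sigma> a) k = ennreal (y (\<sigma> a))"
    by (rule mean_first_passage_time_eq)
  then show "mean_first_passage_time M X T (\<sigma> a) k = ennreal (passage_vec N
      (\<lambda>a b. p (\<sigma> a) (\<sigma> b)) (\<lambda>a. ?\<mu> (\<sigma> a)) a)"
    unfolding y(3)[OF a] .
  show "0 \<le> passage_vec N (\<lambda>a b. p (\<sigma> a) (\<sigma> b)) (\<lambda>a. ?\<mu> (\<sigma> a)) a"
    using y(1)[OF \<sigma>a] unfolding y(3)[OF a] .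
qed

end

theorem mainTheorem7:
  fixes N :: nat
    and M :: "'a measure"
    and Q :: "nat \<Rightarrow> nat \<Rightarrow> real \<Rightarrow> real"
    and X :: "nat \<Rightarrow> 'a \<Rightarrow> nat"
    and T :: "nat \<Rightarrow> 'a \<Rightarrow> real"
  assumes "N \<ge> 2"
    and "markov_renewal_process M N Q X T"
    and "\<And>i. i \<in> {1..N} \<Longrightarrow> measure M {\<omega> \<in> space M. X 0 \<omega> = i} > 0"
    and "irreducible_chain N (transition_prob Q)"
    and "\<And>i. i \<in> {1..N} \<Longrightarrow> mean_holding_time M X T i < \<infinity>"
  shows "let p = transition_prob Q;
             \<mu> = (\<lambda>i. enn2real (mean_holding_time M X T i));
             m = (\<lambda>i j. enn2real (mean_first_passage_time M X T i j));
             pk = (\<lambda>k a b. p (cyc N k a) (cyc N k b));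
             \<mu>k = (\<lambda>k a. \<mu> (cyc N k a));
             x = (\<lambda>k. passage_vec N (pk k) (\<mu>k k))
         in (\<forall>i\<in>{1..N}. \<forall>j\<in>{1..N}. mean_first_passage_time M X T i j < \<infinity>) \<and>
            (\<forall>k\<in>{1..N}.
               (\<forall>n\<in>{2..N}. row_sum (red_p N (pk k) n) n \<noteq> 0) \<and>
               (\<forall>a\<in>{1..N}. x k a = m (cyc N k a) k) \<and>
               map (x k) [1..<N+1] = map (\<lambda>i. m i k) ([k..<N+1] @ [1..<k])) \<and>
            (\<forall>i\<in>{1..N}. \<forall>k\<in>{1..N}. m i k = x k ((i + N - k) mod N + 1))"
proof -
  interpret started_markov_renewal_process M N Q X T
    by (intro started_markov_renewal_process.intro started_markov_renewal_process_axioms.intro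
        assms(2,3))
  have N: "N \<ge> 1" using assms(1) by simp
  define m where "m = (\<lambda>i j. enn2real (mean_first_passage_time M X T i j))"
  define pk where "pk = (\<lambda>k a b. p (cyc N k a) (cyc N k b))"
  define x where "x = (\<lambda>k. passage_vec N (pk k)
    (\<lambda>a. enn2real (mean_holding_time M X T (cyc N k a))))"
  \<comment> \<open>Nonnegativity is recorded because \<open>ennreal\<close> sends negative numbers
    to 0, so \<open>x k a\<close> could not be recovered otherwise.\<close>
  have passage: "mean_first_passage_time M X T (cyc N k a) k = ennreal (x k a)" "0 \<le> x k a"
    if "k \<in> {1..N}" "a \<in> {1..N}" for k a
    unfolding x_def pk_def
    using mean_first_passage_time_passage_vec[OF assms(4,5) cyc_bij[OF that(1)] cyc_one[OF that(1)]
        N that(2)] by auto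
  have x: "x k a = m (cyc N k a) k" if "k \<in> {1..N}" "a \<in> {1..N}" for k a
    unfolding m_def passage(1)[OF that] using passage(2)[OF that] by simp
  have entry: "m i k = x k ((i + N - k) mod N + 1)" if "i \<in> {1..N}" "k \<in> {1..N}" for i k
    using x[OF that(2) cyc_index(1)[OF that]] cyc_index(2)[OF that] by simp
  \<comment> \<open>\<open>enn2real\<close> sends \<open>\<infinity>\<close> to 0, so only
    finiteness makes \<open>m\<close> the true mean.\<close>
  have finite: "mean_first_passage_time M X T i k < \<infinity>" if "i \<in> {1..N}" "k \<in> {1..N}" for i k
    using passage(1)[OF that(2) cyc_index(1)[OF that]] cyc_index(2)[OF that] by simp
  have column: "map (x k) [1..<N+1] = map (\<lambda>i. m i k) ([k..<N+1] @ [1..<k])"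
    if "k \<in> {1..N}" for k
    unfolding map_cyc_upt[OF that, symmetric] map_map comp_def
    by (rule map_cong) (use x[OF that] in auto)
  \<comment> \<open>Division by 0 yields 0 in HOL; this shows that no such default value enters the
    recursion.\<close>
  have pivot: "row_sum (red_p N (pk k) n) n \<noteq> 0" if "k \<in> {1..N}" "n \<in> {2..N}" for k n
    unfolding pk_def
    using red_row_sum_pos[OF stochastic_on_relabel no_closed_subset_relabel that(2),
        OF transition_prob_stochastic cyc_bij _ cyc_bij, OF that(1)
        irreducible_no_closed_subset[OF transition_prob_stochastic assms(4)] that(1)]
    by simp
  show ?thesis
    using finite pivot x column entry unfolding Let_def m_def x_def pk_def by blast
qed

end
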